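(* Let $b\ge 2$ be an integer and let $(T_b,\omega_0,\mu_c)$ be the homogeneous model tree with branching $b$ and root $x_0$, with standard edge weight $\omega_0$ and weighted counting measure $\mu_c\equiv c>0$. Let $d$ be the standard graph distance on $T_b$. Let $V:T_b\to\mathbb{R}$ with $V>0$ on $T_b$, and assume that for some $\alpha>1$, $R_0\ge 2$ and $C_0>0$, $$V(x)\le C_0\,d^{-\alpha}(x,x_0)\quad\text{for all }x\in T_b\setminus B_{R_0}(x_0).$$ Then there exist $\hat C>0$, $\hat R>0$ and $\beta>0$ such that the function $h(x)=\hat C\,d^{-\beta}(x,x_0)$ is a supersolution of the problem $$\frac1V\Delta h=-1\ \text{ in }T_b\setminus B_{\hat R}(x_0),\qquad h>0\ \text{ in }T_b\setminus B_{\hat R}(x_0),\qquad \lim_{d(x,x_0)\to+\infty}h(x)=0,$$ that is: $\frac{1}{V(x)}\Delta h(x)\le -1$ and $h(x)>0$ for every $x\in T_b\setminus B_{\hat R}(x_0)$, and $h(x)\to 0$ as $d(x,x_0)\to+\infty$. Here, for $x\in T_b\setminus B_{\hat R}(x_0)$, $\Delta h(x)$ is computed using the formula $h(y)=\hat C d^{-\beta}(y,x_0)$ also at the neighbours $y$ of $x$, and $\hat R$ is such that no neighbour of a vertex of $T_b\setminus B_{\hat R}(x_0)$ equals $x_0$.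
   Context: The homogeneous model tree $T_b$ with branching $b$ and root $x_0$ is the infinite rooted tree in which every vertex at graph distance $r\ge 0$ from the root $x_0$ is joined to exactly $b$ vertices at distance $r+1$, and every vertex other than $x_0$ is joined to exactly one vertex at distance $r-1$ (so the root has $b$ neighbours and every other vertex has $b+1$ neighbours). The standard graph distance $d(x,y)$ is the number of edges in a shortest path from $x$ to $y$. The standard edge weight is $\omega_0(x,y)=1$ if $x,y$ are joined by an edge (i.e. $d(x,y)=1$) and $\omega_0(x,y)=0$ otherwise. The weighted counting measure $\mu_c$ is the constant function $\mu_c(x)=c$, for a constant $c>0$. The Laplacian is $\Delta f(x)=\frac{1}{\mu_c(x)}\sum_{y\in T_b}[f(y)-f(x)]\,\omega_0(x,y)$. $B_r(x_0)=\{x\in T_b: d(x,x_0)<r\}$, and $d^{p}(x,y)=(d(x,y))^{p}$. *)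

theory Defs
  imports "HOL-Analysis.Analysis" "Graph_Theory.Digraph_Component"
begin

text \<open>Undirected simple graphs, possibly infinite, are represented by the symmetric loopfree
  digraphs \<^locale>\<open>pair_bidirected_digraph\<close>: an edge joining \<open>x\<close> and \<open>y\<close> is the pair of arcs
  \<open>(x, y)\<close> and \<open>(y, x)\<close>.\<close>

text \<open>Only meaningful for vertices joined by some path.\<close>

definition graph_dist :: "'a pair_pre_digraph \<Rightarrow> 'a \<Rightarrow> 'a \<Rightarrow> nat" where
  "graph_dist G x y = (LEAST n. \<exists>p. pre_digraph.apath (with_proj G) x p y \<and> length p = n)"

definition graph_ball :: "'a pair_pre_digraph \<Rightarrow> 'a \<Rightarrow> real \<Rightarrow> 'a set" where
  "graph_ball G x0 r = {x \<in> pverts G. real (graph_dist G x x0) < r}"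

definition std_weight :: "'a pair_pre_digraph \<Rightarrow> 'a \<Rightarrow> 'a \<Rightarrow> real" where
  "std_weight G x y = (if (x, y) \<in> parcs G then 1 else 0)"

text \<open>In a locally finite graph only finitely many terms of the sum are nonzero.\<close>

definition graph_laplacian ::
  "'a pair_pre_digraph \<Rightarrow> ('a \<Rightarrow> 'a \<Rightarrow> real) \<Rightarrow> ('a \<Rightarrow> real) \<Rightarrow> ('a \<Rightarrow> real) \<Rightarrow> 'a \<Rightarrow> real" where
  "graph_laplacian G \<omega> \<mu> f x = 1 / \<mu> x * (\<Sum>\<^sub>\<infinity>y\<in>pverts G. (f y - f x) * \<omega> x y)"

text \<open>The library's \<^const>\<open>tree\<close> cannot be used: in a symmetric digraph every edge, traversed back
  and forth, is a \<^const>\<open>pre_digraph.cycle\<close> of length 2. The cycles of the undirected graph are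
  those of length at least 3. The topological constant \<open>connected\<close> is also in scope, whence the
  qualified name.\<close>

locale homogeneous_model_tree = pair_bidirected_digraph G
  for G :: "'a pair_pre_digraph" +
  fixes x0 :: 'a and b :: nat
  assumes root: "x0 \<in> pverts G"
    and connected: "Digraph_Component.connected (with_proj G)"
    and no_cycles: "\<not> (\<exists>p. pre_digraph.cycle (with_proj G) p \<and> 3 \<le> length p)"
    and outer_nbrs: "x \<in> pverts G \<Longrightarrow>
      finite {y. (x, y) \<in> parcs G \<and> graph_dist G y x0 = graph_dist G x x0 + 1} \<and>
      card {y. (x, y) \<in> parcs G \<and> graph_dist G y x0 = graph_dist G x x0 + 1} = b"
    and inner_nbr: "x \<in> pverts G \<Longrightarrow> x \<noteq> x0 \<Longrightarrow>
      \<exists>!y. (x, y) \<in> parcs G \<and> graph_dist G y x0 + 1 = graph_dist G x x0"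

definition dist_to_infinity :: "'a pair_pre_digraph \<Rightarrow> 'a \<Rightarrow> 'a filter" where
  "dist_to_infinity G x0 =
     inf (filtercomap (\<lambda>x. graph_dist G x x0) at_top) (principal (pverts G))"

text \<open>Supersolution of \<open>(1/V) \<Delta>h = -1\<close> and \<open>h > 0\<close> outside the ball of radius \<open>R\<close>, with \<open>h\<close>
  vanishing at infinity.\<close>

definition exterior_supersolution ::
  "'a pair_pre_digraph \<Rightarrow> ('a \<Rightarrow> 'a \<Rightarrow> real) \<Rightarrow> ('a \<Rightarrow> real) \<Rightarrow> 'a \<Rightarrow> ('a \<Rightarrow> real) \<Rightarrow> real
     \<Rightarrow> ('a \<Rightarrow> real) \<Rightarrow> bool" where
  "exterior_supersolution G \<omega> \<mu> x0 V R h \<longleftrightarrow>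
     (\<forall>x \<in> pverts G - graph_ball G x0 R. 1 / V x * graph_laplacian G \<omega> \<mu> h x \<le> - 1) \<and>
     (\<forall>x \<in> pverts G - graph_ball G x0 R. h x > 0) \<and>
     (h \<longlongrightarrow> 0) (dist_to_infinity G x0)"

end

theory Submission
  imports Defs "HOL-Real_Asymp.Real_Asymp"
begin

text \<open>Write \<open>r = d(x, x0)\<close>. A vertex with \<open>r \<ge> 1\<close> has \<open>b\<close> neighbours at distance \<open>r + 1\<close> and
  one at distance \<open>r - 1\<close>; any other neighbour would be at distance \<open>r\<close> and so contributes nothing
  to the Laplacian of a radial function. Hence, for \<open>h = C d powr -\<beta>\<close>, the quantity
  \<open>c * \<Delta>h / C = b ((r + 1) powr -\<beta> - r powr -\<beta>) + ((r - 1) powr -\<beta> - r powr -\<beta>)\<close>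
  is asymptotic to \<open>-(b - 1) \<beta> r powr (-\<beta> - 1)\<close>. With \<open>\<beta> = \<alpha> - 1\<close> this has the decay rate of
  the bound on \<open>V\<close>, so a large \<open>C\<close> makes \<open>\<Delta>h \<le> -V\<close> far from the root.\<close>

context homogeneous_model_tree
begin

text \<open>Ensures that the \<open>LEAST\<close> in \<open>graph_dist\<close> is attained: arcs are
  symmetric, so connectedness is strong connectedness, and reachability yields a path without
  repeated vertices.\<close>

lemma exists_apath_to_root:
  assumes "x \<in> pverts G"
  shows "\<exists>p. apath x p x0"
proof -
  have "strongly_connected (with_proj G)"
    using connected by (intro symmetric_connected_imp_strongly_connected sym_arcs)
  then have "x \<rightarrow>\<^sup>*\<^bsub>with_proj G\<^esub> x0"
    using assms root by (auto elim!: strongly_connectedE)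
  then show ?thesis
    using reachable_apath by auto
qed

lemma graph_dist_apath:
  assumes "x \<in> pverts G"
  obtains p where "apath x p x0" "length p = graph_dist G x x0"
proof -
  have "\<exists>n p. apath x p x0 \<and> length p = n"
    using exists_apath_to_root[OF assms] by blast
  from LeastI_ex[OF this] show ?thesis
    using that unfolding graph_dist_def by blast
qed

lemma graph_dist_le_length: "apath x p y \<Longrightarrow> graph_dist G x y \<le> length p"
  unfolding graph_dist_def by (rule Least_le) blast

lemma graph_dist_root [simp]: "graph_dist G x0 x0 = 0"
  using graph_dist_le_length[of x0 "[]" x0] root by (simp add: apath_Nil_iff)

lemma graph_dist_eq_0_iff:
  assumes "x \<in> pverts G"
  shows "graph_dist G x x0 = 0 \<longleftrightarrow> x = x0"
proof
  assume "graph_dist G x x0 = 0"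
  with graph_dist_apath[OF assms] show "x = x0"
    by (metis apath_Nil_iff length_0_conv)
qed simp

lemma graph_dist_arc_le:
  assumes "(y, x) \<in> parcs G"
  shows "graph_dist G y x0 \<le> graph_dist G x x0 + 1"
proof -
  have "x \<in> pverts G"
    using assms by (rule in_arcsD2)
  then obtain p where p: "apath x p x0" "length p = graph_dist G x x0"
    by (rule graph_dist_apath)
  show ?thesis
  \<comment> \<open>Prepending \<open>y\<close> to a shortest path may repeat a vertex; if
    \<open>y\<close> already lies on the path, its tail from \<open>y\<close> is short
    enough.\<close>
  proof (cases "y \<in> set (awalk_verts x p)")
    case True
    from awalk_decomp[OF awalkI_apath[OF p(1)] True]
    obtain q r where qr: "p = q @ r" "awalk x q y" "awalk y r x0"
      by (elim exE conjE)
    have "awlast x q = y"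
      using qr(2) by simp
    moreover have "apath x (q @ r) x0"
      using p(1) qr(1) by simp
    ultimately have "apath y r x0"
      by (simp add: apath_append_iff)
    from graph_dist_le_length[OF this] show ?thesis
      using p(2) qr(1) by simp
  next
    case False
    then have "apath y ((y, x) # p) x0"
      using p assms by (simp add: apath_Cons_iff)
    from graph_dist_le_length[OF this] show ?thesis
      using p(2) by simp
  qed
qed

lemma laplacian_radial:
  fixes f :: "nat \<Rightarrow> real"
  assumes x: "x \<in> pverts G" "x \<noteq> x0"
  defines "r \<equiv> graph_dist G x x0"
  shows "graph_laplacian G (std_weight G) (\<lambda>_. c) (\<lambda>y. f (graph_dist G y x0)) x =
    1 / c * (real b * (f (r + 1) - f r) + (f (r - 1) - f r))"
proof -
  define U where "U = {y. (x, y) \<in> parcs G \<and> graph_dist G y x0 = r + 1}"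
  let ?g = "\<lambda>y. (f (graph_dist G y x0) - f r) * std_weight G x y"
  have U: "finite U" "card U = b"
    using outer_nbrs[OF x(1)] by (auto simp: U_def r_def)
  obtain z where z: "(x, z) \<in> parcs G" "graph_dist G z x0 + 1 = r"
    and z_unique: "\<And>y. (x, y) \<in> parcs G \<Longrightarrow> graph_dist G y x0 + 1 = r \<Longrightarrow> y = z"
    using inner_nbr[OF x] unfolding r_def by blast
  \<comment> \<open>The arc bound in both directions puts a neighbour within 1 of \<open>r\<close>.
    Outside \<open>insert z U\<close> only distance \<open>r\<close> remains, where the first factor
    vanishes; for a non-neighbour the weight vanishes. So the sum has finite support.\<close>
  have other: "?g y = 0" if "y \<notin> insert z U" for y
  proof (cases "(x, y) \<in> parcs G")
    case True
    then have "(y, x) \<in> parcs G"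
      using arcs_symmetric by blast
    with True have "graph_dist G y x0 \<le> r + 1" "r \<le> graph_dist G y x0 + 1"
      using graph_dist_arc_le unfolding r_def by blast+
    moreover have "graph_dist G y x0 \<noteq> r + 1" "graph_dist G y x0 + 1 \<noteq> r"
      using that True z_unique by (auto simp: U_def)
    ultimately have "graph_dist G y x0 = r"
      by linarith
    then show ?thesis
      by simp
  qed (simp add: std_weight_def)
  have "insert z U \<subseteq> pverts G"
    using z(1) in_arcsD2 by (auto simp: U_def)
  then have "(\<Sum>\<^sub>\<infinity>y\<in>pverts G. ?g y) = (\<Sum>\<^sub>\<infinity>y\<in>insert z U. ?g y)"
    using other by (intro infsum_cong_neutral) auto
  also have "\<dots> = (\<Sum>y\<in>insert z U. ?g y)"
    using U by simp
  also have "\<dots> = ?g z + (\<Sum>y\<in>U. ?g y)"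
    using U z(2) by (intro sum.insert) (auto simp: U_def)
  also have "(\<Sum>y\<in>U. ?g y) = (\<Sum>y\<in>U. f (r + 1) - f r)"
    by (rule sum.cong) (auto simp: U_def std_weight_def)
  also have "graph_dist G z x0 = r - 1"
    using z(2) by simp
  finally show ?thesis
    using U z(1) by (simp add: graph_laplacian_def r_def [symmetric] std_weight_def add.commute)
qed

end

text \<open>To first order, \<open>(r + 1) powr -\<beta>\<close> and
  \<open>(r - 1) powr -\<beta>\<close> differ from \<open>r powr -\<beta>\<close> by
  \<open>-\<beta>\<close> and \<open>\<beta>\<close> times \<open>r powr (-\<beta> - 1)\<close>. The
  quotient thus tends to \<open>-(b - 1) \<beta> < 0\<close>; giving up half of this constant
  absorbs the error terms.\<close>

lemma eventually_radial_laplacian_le: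
  fixes b \<beta> :: real
  assumes "\<beta> > 0" "b > 1"
  shows "\<forall>\<^sub>F r :: nat in sequentially.
    b * (real (r + 1) powr -\<beta> - real r powr -\<beta>) + (real (r - 1) powr -\<beta> - real r powr -\<beta>)
      \<le> - ((b - 1) * \<beta> / 2) * real r powr (- \<beta> - 1)"
proof -
  have "((\<lambda>r :: nat. (b * ((real r + 1) powr -\<beta> - real r powr -\<beta>) +
      ((real r - 1) powr -\<beta> - real r powr -\<beta>)) / real r powr (- \<beta> - 1))
      \<longlonglongrightarrow> \<beta> - b * \<beta>)"
    using assms by real_asymp
  moreover have "\<beta> - b * \<beta> < - ((b - 1) * \<beta> / 2)"
    using mult_pos_pos[of "b - 1" \<beta>] assms by (simp add: field_simps)
  ultimately have "\<forall>\<^sub>F r :: nat in sequentially.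
      (b * ((real r + 1) powr -\<beta> - real r powr -\<beta>) +
      ((real r - 1) powr -\<beta> - real r powr -\<beta>)) / real r powr (- \<beta> - 1)
      < - ((b - 1) * \<beta> / 2)"
    by (rule order_tendstoD)
  \<comment> \<open>For \<open>r > 0\<close> the truncated \<open>r - 1\<close> is the true
    difference and the divisor is positive.\<close>
  then show ?thesis
    using eventually_gt_at_top[of 0]
  proof eventually_elim
    case (elim r)
    then have "real r powr (- \<beta> - 1) > 0" "real (r - 1) = real r - 1"
      by (auto simp: of_nat_diff)
    with elim(1) show ?case
      by (simp add: pos_divide_less_eq add.commute)
  qed
qed

lemma tendsto_dist_to_infinity:
  assumes "(f \<longlongrightarrow> l) sequentially"
  shows "((\<lambda>x. f (graph_dist G x x0)) \<longlongrightarrow> l) (dist_to_infinity G x0)"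
proof -
  have "filterlim (\<lambda>x. graph_dist G x x0) at_top (dist_to_infinity G x0)"
    unfolding dist_to_infinity_def
    by (rule filterlim_mono[OF filterlim_filtercomap]) auto
  with assms show ?thesis
    by (rule filterlim_compose)
qed

theorem lemma7p3:
  fixes G :: "'a pair_pre_digraph" and x0 :: 'a and b :: nat
    and c \<alpha> R0 C0 :: real and V :: "'a \<Rightarrow> real"
  assumes "b \<ge> 2"
    and "homogeneous_model_tree G x0 b"
    and "c > 0"
    and "\<And>x. x \<in> pverts G \<Longrightarrow> V x > 0"
    and "\<alpha> > 1" and "R0 \<ge> 2" and "C0 > 0"
    and "\<And>x. x \<in> pverts G - graph_ball G x0 R0 \<Longrightarrow>
           V x \<le> C0 * real (graph_dist G x x0) powr (- \<alpha>)"
  shows "\<exists>Ch Rh \<beta> :: real. Ch > 0 \<and> Rh > 0 \<and> \<beta> > 0 \<and>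
    (\<forall>x \<in> pverts G - graph_ball G x0 Rh. \<forall>y. (x, y) \<in> parcs G \<longrightarrow> y \<noteq> x0) \<and>
    exterior_supersolution G (std_weight G) (\<lambda>_. c) x0 V Rh
      (\<lambda>x. Ch * real (graph_dist G x x0) powr (- \<beta>))"
proof -
  interpret homogeneous_model_tree G x0 b by fact
  define \<beta> where "\<beta> = \<alpha> - 1"
  \<comment> \<open>\<open>K\<close> is the constant of the asymptotic bound, and \<open>Ch\<close>
    solves \<open>Ch / c * K = C0\<close>, so that the Laplacian is at most minus the bound on
    \<open>V\<close>.\<close>
  define K where "K = (real b - 1) * \<beta> / 2"
  define Ch where "Ch = c * C0 / K"
  have "\<beta> > 0" "K > 0" "Ch > 0"
    using assms(1,3,5,7) by (simp_all add: \<beta>_def K_def Ch_def)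
  obtain N where N: "\<And>r. r \<ge> N \<Longrightarrow>
      real b * (real (r + 1) powr -\<beta> - real r powr -\<beta>) +
      (real (r - 1) powr -\<beta> - real r powr -\<beta>) \<le> - K * real r powr -\<alpha>"
    using eventually_radial_laplacian_le[of \<beta> "real b"] \<open>\<beta> > 0\<close> assms(1)
    unfolding eventually_sequentially K_def by (auto simp: \<beta>_def)
  \<comment> \<open>Beyond \<open>R0\<close> the bound on \<open>V\<close> holds, beyond
    \<open>N\<close> the asymptotic one. As \<open>R0 \<ge> 2\<close>, neighbours of exterior
    vertices have distance at least 1, which avoids the default value
    \<open>0 powr -\<beta> = 0\<close>.\<close>
  define Rh where "Rh = max R0 (real N)"
  define h where "h = (\<lambda>r :: nat. Ch * real r powr -\<beta>)"
  have far: "graph_dist G x x0 \<ge> 2" "graph_dist G x x0 \<ge> N" "x \<noteq> x0"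
    "x \<in> pverts G" "x \<in> pverts G - graph_ball G x0 R0"
    if "x \<in> pverts G - graph_ball G x0 Rh" for x
    using that assms(6) graph_dist_eq_0_iff[of x] by (auto simp: graph_ball_def Rh_def)
  have "1 / V x * graph_laplacian G (std_weight G) (\<lambda>_. c) (\<lambda>x. h (graph_dist G x x0)) x \<le> -1"
    if x: "x \<in> pverts G - graph_ball G x0 Rh" for x
  proof -
    let ?r = "graph_dist G x x0"
    let ?D = "real b * (real (?r + 1) powr -\<beta> - real ?r powr -\<beta>) +
      (real (?r - 1) powr -\<beta> - real ?r powr -\<beta>)"
    have "graph_laplacian G (std_weight G) (\<lambda>_. c) (\<lambda>x. h (graph_dist G x x0)) x
        = Ch / c * ?D"
      unfolding laplacian_radial[OF far(4)[OF x] far(3)[OF x]] by (simp add: h_def algebra_simps)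
    also have "\<dots> \<le> Ch / c * (- K * real ?r powr -\<alpha>)"
      using N[OF far(2)[OF x]] \<open>Ch > 0\<close> assms(3) by (intro mult_left_mono) auto
    also have "\<dots> = - (C0 * real ?r powr -\<alpha>)"
      using \<open>K > 0\<close> assms(3) by (simp add: Ch_def)
    also have "\<dots> \<le> - V x"
      using assms(8)[OF far(5)[OF x]] by simp
    finally show ?thesis
      using assms(4)[OF far(4)[OF x]] by (simp add: pos_divide_le_eq)
  qed
  moreover have "h (graph_dist G x x0) > 0" if "x \<in> pverts G - graph_ball G x0 Rh" for x
    using far(1)[OF that] \<open>Ch > 0\<close> by (simp add: h_def)
  moreover have "((\<lambda>x. h (graph_dist G x x0)) \<longlongrightarrow> 0) (dist_to_infinity G x0)"
  proof (rule tendsto_dist_to_infinity)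
    show "h \<longlonglongrightarrow> 0"
      unfolding h_def using \<open>\<beta> > 0\<close> by real_asymp
  qed
  ultimately have "exterior_supersolution G (std_weight G) (\<lambda>_. c) x0 V Rh
      (\<lambda>x. Ch * real (graph_dist G x x0) powr -\<beta>)"
    unfolding exterior_supersolution_def h_def by blast
  \<comment> \<open>A neighbour equal to \<open>x0\<close> would force the distance of
    \<open>x\<close> to be at most 1.\<close>
  moreover have "y \<noteq> x0" if "x \<in> pverts G - graph_ball G x0 Rh" "(x, y) \<in> parcs G" for x y
    using graph_dist_arc_le[OF that(2)] far(1)[OF that(1)] by auto
  moreover have "Rh > 0"
    using assms(6) by (simp add: Rh_def)
  ultimately show ?thesis
    using \<open>Ch > 0\<close> \<open>\<beta> > 0\<close> by blast
qed

end
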